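(* The class of languages decided by constant space Turing machines with quasipolynomial-size advice equals nonuniform-$\mathsf{polyL}$.
   Context: A constant space Turing machine with advice is a deterministic Turing machine with a read-only two-way input tape holding $x$, a separate read-only two-way advice tape holding an advice string, and a work tape of which only a constant number of cells (independent of the input and the advice) is ever used. The machine has quasipolynomial-size advice if there is a sequence $(a_n)_{n\ge1}$ of advice strings, depending only on the input length, with $|a_n|\le 2^{(\log n)^{c}}$ for some constant $c$, and on input $x$ the advice tape holds $a_{|x|}$; it decides $L$ if for all $x$, $x\in L$ iff it accepts $x$ with advice $a_{|x|}$. Nonuniform-$\mathsf{polyL}$ is the class of languages decided by deterministic Turing machines using $(\log n)^{O(1)}$ work space with quasipolynomial-size advice (same read-only two-way input and advice tapes); equivalently, the class of languages decided by a nonuniform family of branching programs of size $2^{(\log n)^{O(1)}}$. *)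

theory Defs
  imports Complex_Main
begin

text \<open>
Deterministic Turing machines with a read-only two-way input tape, a read-only
two-way advice tape and one work tape (one-way infinite to the right).
Inputs and advice strings are binary (bool lists). States are the naturals
below tm_nstates, work symbols the naturals below tm_nsyms, with blank 0.
Read-only tapes are delimited by endmarkers: position 0 holds the left
endmarker (symbol 0), positions 1..n hold the string (False = 2, True = 3),
position n+1 holds the right endmarker (symbol 1); the read-only heads are
confined to 0..n+1. The transition maps
(state, input symbol, advice symbol, work symbol) to
(new state, written work symbol, input move, advice move, work move),
moves in {-1,0,1}. The machine halts in the accepting or rejecting state.
\<close>

datatype tm = TM
  (tm_nstates: nat) (tm_nsyms: nat) (tm_start: nat) (tm_acc: nat) (tm_rej: nat)
  (tm_delta: "nat \<Rightarrow> nat \<Rightarrow> nat \<Rightarrow> nat \<Rightarrow> nat \<times> nat \<times> int \<times> int \<times> int")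

datatype conf = Conf
  (c_state: nat) (c_ipos: nat) (c_apos: nat) (c_wtape: "nat \<Rightarrow> nat") (c_wpos: nat)

definition tape_sym :: "bool list \<Rightarrow> nat \<Rightarrow> nat" where
  "tape_sym w i = (if i = 0 then 0 else if i \<le> length w then (if w ! (i - 1) then 3 else 2) else 1)"

definition is_move :: "int \<Rightarrow> bool" where
  "is_move d \<longleftrightarrow> d \<in> {-1, 0, 1}"

definition wf_tm :: "tm \<Rightarrow> bool" where
  "wf_tm M \<longleftrightarrow>
     0 < tm_nsyms M \<and> tm_start M < tm_nstates M \<and> tm_acc M < tm_nstates M \<and>
     tm_rej M < tm_nstates M \<and> tm_acc M \<noteq> tm_rej M \<and>
     (\<forall>q < tm_nstates M. \<forall>i < 4. \<forall>a < 4. \<forall>g < tm_nsyms M.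
        (case tm_delta M q i a g of (q', g', di, da, dw) \<Rightarrow>
           q' < tm_nstates M \<and> g' < tm_nsyms M \<and> is_move di \<and> is_move da \<and> is_move dw))"

definition move_ro :: "bool list \<Rightarrow> nat \<Rightarrow> int \<Rightarrow> nat" where
  "move_ro w i d = nat (min (int (length w + 1)) (max 0 (int i + d)))"

definition move_work :: "nat \<Rightarrow> int \<Rightarrow> nat" where
  "move_work j d = nat (max 0 (int j + d))"

definition init_conf :: "tm \<Rightarrow> conf" where
  "init_conf M = Conf (tm_start M) 0 0 (\<lambda>_. 0) 0"

definition step :: "tm \<Rightarrow> bool list \<Rightarrow> bool list \<Rightarrow> conf \<Rightarrow> conf" where
  "step M x adv c =
     (if c_state c = tm_acc M \<or> c_state c = tm_rej M then c
      else (case tm_delta M (c_state c) (tape_sym x (c_ipos c)) (tape_sym adv (c_apos c))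
                   (c_wtape c (c_wpos c)) of
              (q', g', di, da, dw) \<Rightarrow>
                Conf q' (move_ro x (c_ipos c) di) (move_ro adv (c_apos c) da)
                     ((c_wtape c)(c_wpos c := g')) (move_work (c_wpos c) dw)))"

definition run :: "tm \<Rightarrow> bool list \<Rightarrow> bool list \<Rightarrow> nat \<Rightarrow> conf" where
  "run M x adv t = (step M x adv ^^ t) (init_conf M)"

definition accepts :: "tm \<Rightarrow> bool list \<Rightarrow> bool list \<Rightarrow> bool" where
  "accepts M x adv \<longleftrightarrow> (\<exists>t. c_state (run M x adv t) = tm_acc M)"

definition space_within :: "tm \<Rightarrow> bool list \<Rightarrow> bool list \<Rightarrow> real \<Rightarrow> bool" where
  "space_within M x adv s \<longleftrightarrow> (\<forall>t. real (c_wpos (run M x adv t) + 1) \<le> s)"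

definition qp_advice :: "(nat \<Rightarrow> bool list) \<Rightarrow> bool" where
  "qp_advice a \<longleftrightarrow> (\<exists>c::real. \<forall>n \<ge> 1. real (length (a n)) \<le> 2 powr ((log 2 (real n)) powr c))"

definition decides :: "tm \<Rightarrow> (nat \<Rightarrow> bool list) \<Rightarrow> bool list set \<Rightarrow> bool" where
  "decides M a L \<longleftrightarrow> (\<forall>x. x \<in> L \<longleftrightarrow> accepts M x (a (length x)))"

definition const_space_qp_advice :: "bool list set set" where
  "const_space_qp_advice =
     {L. \<exists>M a s. wf_tm M \<and> qp_advice a \<and>
          (\<forall>x. space_within M x (a (length x)) (real s)) \<and> decides M a L}"

definition nonuniform_polyL :: "bool list set set" where
  "nonuniform_polyL =
     {L. \<exists>M a (c::nat). wf_tm M \<and> qp_advice a \<and>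
          (\<forall>x. space_within M x (a (length x)) (real c * (log 2 (real (length x) + 2)) ^ c)) \<and>
          decides M a L}"

end

theory Submission
  imports Defs
begin

text \<open>
  A machine with polylogarithmic space and quasipolynomial advice has, for each input length,
  quasipolynomially many configurations, and one step out of a fixed configuration depends on a
  single input symbol. Whether \<open>2 ^ (k + 1)\<close> steps lead from \<open>u\<close> to \<open>v\<close> is a disjunction over
  midpoints, as in Savitch's theorem; since the machine is deterministic the midpoint is unique, so
  the disjunction is a sum over GF(2). Such sums of products are evaluated with three one-bit
  registers by straight-line programs in the style of Ben-Or and Cleve, each doubling of the time
  multiplying the program length by a quasipolynomial factor. After polylogarithmically many
  doublings the program is still of quasipolynomial length. It becomes the advice of a machine that
  reads it once from left to right and remembers only the registers and the current opcode.

  For \<open>n = 1\<close> and \<open>n = 2\<close> the bound \<open>2 powr (log 2 n powr c)\<close> allows only one and two bits of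
  advice, whatever \<open>c\<close> is, so the answers for inputs of length at most 2 are built into the
  transition function.
\<close>

subsection \<open>Straight-line programs over three one-bit registers\<close>

definition op_dir :: "nat \<Rightarrow> int" where
  "op_dir k = (if k = 0 then -1 else if k = 1 then 1 else 0)"

text \<open>
  Opcodes 0 and 1 move the input head. The opcode \<open>2 + i + 3 * j\<close> adds register \<open>i\<close> to register
  \<open>j\<close>, and \<open>11 + i + 3 * j\<close> does so only if the scanned input bit is 1.
\<close>
definition op_upd :: "nat \<Rightarrow> nat \<Rightarrow> (nat \<Rightarrow> bool) \<Rightarrow> nat \<Rightarrow> bool" where
  "op_upd s k R =
     (if k < 2 then R
      else let i = (k - 2) mod 3; j = (k - 2) div 3 mod 3
           in R(j := (R j \<noteq> (R i \<and> (11 \<le> k \<longrightarrow> s = 3)))))"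

definition exec_op :: "bool list \<Rightarrow> nat \<Rightarrow> (nat \<Rightarrow> bool) \<times> nat \<Rightarrow> (nat \<Rightarrow> bool) \<times> nat" where
  "exec_op x k = (\<lambda>(R, p). (op_upd (tape_sym x p) k R, move_ro x p (op_dir k)))"

definition exec :: "bool list \<Rightarrow> nat list \<Rightarrow> (nat \<Rightarrow> bool) \<times> nat \<Rightarrow> (nat \<Rightarrow> bool) \<times> nat" where
  "exec x = fold (exec_op x)"

lemma exec_simps [simp]:
  "exec x [] s = s"
  "exec x (k # P) s = exec x P (exec_op x k s)"
  "exec x (P @ Q) s = exec x Q (exec x P s)"
  by (simp_all add: exec_def)

text \<open>Over GF(2) the program adds \<open>f x * R i\<close> to register \<open>j\<close>.
  Demanding this for every \<open>R\<close>, with the other registers and head position 0 restored,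
  lets programs be concatenated whatever the registers hold.\<close>

definition implements :: "nat \<Rightarrow> nat list \<Rightarrow> (bool list \<Rightarrow> bool) \<Rightarrow> nat \<Rightarrow> nat \<Rightarrow> bool" where
  "implements n P f i j \<longleftrightarrow> set P \<subseteq> {..<20} \<and>
     (\<forall>x R. length x = n \<longrightarrow> exec x P (R, 0) = (R(j := (R j \<noteq> (f x \<and> R i))), 0))"

text \<open>All ordered pairs of registers are covered because composition uses a third register
  both as a target and as a source.\<close>

definition computable :: "nat \<Rightarrow> (bool list \<Rightarrow> bool) \<Rightarrow> nat \<Rightarrow> bool" where
  "computable n f l \<longleftrightarrow>
     (\<forall>i<3. \<forall>j<3. i \<noteq> j \<longrightarrow> (\<exists>P. length P \<le> l \<and> implements n P f i j))"

lemma computable_mono: "computable n f l \<Longrightarrow> l \<le> m \<Longrightarrow> computable n f m"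
  unfolding computable_def by (meson le_trans)

lemma computable_cong:
  "(\<And>x. length x = n \<Longrightarrow> f x = g x) \<Longrightarrow> computable n f l \<Longrightarrow> computable n g l"
  unfolding computable_def implements_def by (simp cong: conj_cong)

lemma computable_xor:
  assumes "computable n f l" "computable n g m"
  shows "computable n (\<lambda>x. f x \<noteq> g x) (l + m)"
  unfolding computable_def
proof (intro allI impI)
  fix i j :: nat assume ij: "i < 3" "j < 3" "i \<noteq> j"
  from assms ij obtain P Q where "length P \<le> l" "implements n P f i j"
    "length Q \<le> m" "implements n Q g i j" unfolding computable_def by meson
  then have "length (P @ Q) \<le> l + m \<and> implements n (P @ Q) (\<lambda>x. f x \<noteq> g x) i j"
    using ij by (auto simp: implements_def fun_eq_iff)
  then show "\<exists>P. length P \<le> l + m \<and> implements n P (\<lambda>x. f x \<noteq> g x) i j" by blast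
qed

text \<open>
  The Ben-Or--Cleve commutator: with \<open>k\<close> the third register, adding \<open>f * R i\<close> to \<open>R k\<close> and
  \<open>g * R k\<close> to \<open>R j\<close>, twice each, restores \<open>R k\<close> and leaves exactly \<open>f * g * R i\<close> in \<open>R j\<close>.
\<close>
lemma computable_and:
  assumes "computable n f l" "computable n g m"
  shows "computable n (\<lambda>x. f x \<and> g x) (2 * (l + m))"
  unfolding computable_def
proof (intro allI impI)
  fix i j :: nat assume ij: "i < 3" "j < 3" "i \<noteq> j"
  \<comment> \<open>The indices 0, 1, 2 add up to 3, so this is the remaining one.\<close>
  define k where "k = 3 - i - j"
  have k: "k < 3" "k \<noteq> i" "k \<noteq> j" using ij unfolding k_def by presburger+
  from assms ij k obtain P Q where "length P \<le> l" "implements n P f i k"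
    "length Q \<le> m" "implements n Q g k j" unfolding computable_def by metis
  then have "length (P @ Q @ P @ Q) \<le> 2 * (l + m) \<and>
      implements n (P @ Q @ P @ Q) (\<lambda>x. f x \<and> g x) i j"
    using ij k by (auto simp: implements_def fun_eq_iff)
  then show "\<exists>P. length P \<le> 2 * (l + m) \<and> implements n P (\<lambda>x. f x \<and> g x) i j" by blast
qed

text \<open>The \<open>min\<close> is the clamp of a stay move and vanishes for a head on the tape.
  The flag \<open>c\<close> shifts the opcode by 9, from the unconditional to the conditional
  block.\<close>

lemma exec_op_add:
  assumes "i < 3" "j < 3"
  shows "exec_op x (2 + i + 3 * j + (if c then 9 else 0)) (R, p) =
     (R(j := (R j \<noteq> (R i \<and> (c \<longrightarrow> tape_sym x p = 3)))), min (length x + 1) p)"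
proof -
  have "(i + 3 * j + 9) mod 3 = i" "(i + 3 * j + 9) div 3 mod 3 = j"
    "(i + 3 * j) mod 3 = i" "(i + 3 * j) div 3 mod 3 = j"
  proof -
    have "i = 0 \<or> i = 1 \<or> i = 2" "j = 0 \<or> j = 1 \<or> j = 2" using assms by linarith+
    then show "(i + 3 * j + 9) mod 3 = i" "(i + 3 * j + 9) div 3 mod 3 = j"
      "(i + 3 * j) mod 3 = i" "(i + 3 * j) div 3 mod 3 = j" by auto
  qed
  then show ?thesis using assms
    by (auto simp: exec_op_def op_upd_def op_dir_def move_ro_def fun_eq_iff Let_def add.commute)
qed

lemma exec_right:
  "p + m \<le> length x + 1 \<Longrightarrow> exec x (replicate m 1) (R, p) = (R, p + m)"
  by (induction m arbitrary: p) (auto simp: exec_op_def op_upd_def op_dir_def move_ro_def)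

text \<open>Truncated subtraction agrees with the clamp at the left endmarker, so surplus left moves
  are harmless and rewind the head.\<close>

lemma exec_left:
  "p \<le> length x + 1 \<Longrightarrow> exec x (replicate m 0) (R, p) = (R, p - m)"
proof (induction m arbitrary: p)
  case (Suc m)
  have "exec_op x 0 (R, p) = (R, p - 1)"
    using Suc.prems by (auto simp: exec_op_def op_upd_def op_dir_def move_ro_def)
  with Suc show ?case by simp
qed simp

lemma computable_const: "computable n (\<lambda>x. b) 1"
  unfolding computable_def
proof (intro allI impI)
  fix i j :: nat assume ij: "i < 3" "j < 3" "i \<noteq> j"
  show "\<exists>P. length P \<le> 1 \<and> implements n P (\<lambda>x. b) i j"
  proof (cases b)
    case True
    then show ?thesis using ij exec_op_add[OF ij(1,2), where c = False]
      by (intro exI[of _ "[2 + i + 3 * j]"]) (auto simp: implements_def)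
  next
    case False
    then show ?thesis by (intro exI[of _ "[]"]) (auto simp: implements_def)
  qed
qed

text \<open>Walk to cell \<open>q\<close>, add conditionally, walk back the same number of
  cells.\<close>

lemma computable_bit:
  assumes "q \<le> n + 1"
  shows "computable n (\<lambda>x. tape_sym x q = 3) (2 * n + 3)"
  unfolding computable_def
proof (intro allI impI)
  fix i j :: nat assume ij: "i < 3" "j < 3" "i \<noteq> j"
  let ?P = "replicate q 1 @ [2 + i + 3 * j + 9] @ replicate q 0"
  have "exec x ?P (R, 0) = (R(j := (R j \<noteq> (tape_sym x q = 3 \<and> R i))), 0)"
    if "length x = n" for x R
    using that assms exec_right[of 0 q x] exec_left[of q x q] exec_op_add[OF ij(1,2), where c = True]
    by (auto simp: fun_eq_iff)
  then have "implements n ?P (\<lambda>x. tape_sym x q = 3) i j"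
    using ij by (auto simp: implements_def)
  moreover have "length ?P \<le> 2 * n + 3 \<or> q = n + 1" using assms by auto
  moreover have "computable n (\<lambda>x. tape_sym x q = 3) 1" if "q = n + 1"
    by (rule computable_cong[OF _ computable_const[where b = False]]) (simp add: that tape_sym_def)
  ultimately show "\<exists>P. length P \<le> 2 * n + 3 \<and> implements n P (\<lambda>x. tape_sym x q = 3) i j"
    using ij computable_mono[of n "\<lambda>x. tape_sym x q = 3" 1 "2 * n + 3"]
    unfolding computable_def by (metis le_add2 add.commute le_add1 one_le_numeral trans_le_add2)
qed

text \<open>At fixed length the symbol at \<open>q\<close> takes at most two values, so
  \<open>f\<close> is a constant, the bit test or its negation.\<close>

lemma computable_local:
  assumes q: "q \<le> n + 1"
    and f: "\<And>x y. length x = n \<Longrightarrow> length y = n \<Longrightarrow> tape_sym x q = tape_sym y q \<Longrightarrow> f x \<Longrightarrow> f y"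
  shows "computable n f (2 * n + 4)"
proof -
  \<comment> \<open>\<open>g b\<close> is the value of \<open>f\<close> on inputs whose test at
    \<open>q\<close> gives \<open>b\<close>; it is \<open>False\<close> if there are none, as for
    \<open>b = True\<close> at an endmarker.\<close>
  define g where "g b \<longleftrightarrow> (\<exists>x. length x = n \<and> (tape_sym x q = 3) = b \<and> f x)" for b
  have fg: "f x = g (tape_sym x q = 3)" if x: "length x = n" for x
  proof
    assume "g (tape_sym x q = 3)"
    then obtain y where y: "length y = n" "(tape_sym y q = 3) = (tape_sym x q = 3)" "f y"
      by (auto simp: g_def)
    \<comment> \<open>Equal lengths make \<open>q\<close> an endmarker in both inputs or a bit in
      both, so agreeing on the test forces equal symbols.\<close>
    have "tape_sym y q = tape_sym x q"
      using x y(1,2) by (auto simp: tape_sym_def split: if_splits)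
    then show "f x" using f x y by blast
  qed (use x in \<open>auto simp: g_def\<close>)
  have bit: "computable n (\<lambda>x. tape_sym x q = 3) (2 * n + 3)" by (rule computable_bit[OF q])
  have const: "computable n (\<lambda>x. b) (2 * n + 4)" for b
    by (rule computable_mono[OF computable_const]) simp
  have neg: "computable n (\<lambda>x. (tape_sym x q = 3) \<noteq> True) (2 * n + 4)"
    using computable_xor[OF bit computable_const[of n True]] by (rule computable_mono) simp
  consider "g True = g False" | "g True" "\<not> g False" | "\<not> g True" "g False" by blast
  then show ?thesis
  proof cases
    case 1
    then show ?thesis by (intro computable_cong[OF _ const[of "g True"]]) (metis (full_types) fg)
  next
    case 2
    then show ?thesis
      by (intro computable_cong[OF _ computable_mono[OF bit]]) (metis (full_types) fg, simp)
  next
    case 3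
    then show ?thesis
      by (intro computable_cong[OF _ neg]) (metis (full_types) fg)
  qed
qed

text \<open>Over GF(2) a disjunction is a sum as soon as at most one disjunct can hold.\<close>
lemma computable_ex:
  assumes "finite C" "\<And>w. w \<in> C \<Longrightarrow> computable n (f w) l"
    and "\<And>x w w'. length x = n \<Longrightarrow> w \<in> C \<Longrightarrow> w' \<in> C \<Longrightarrow> f w x \<Longrightarrow> f w' x \<Longrightarrow> w = w'"
  shows "computable n (\<lambda>x. \<exists>w\<in>C. f w x) (1 + card C * l)"
  using assms
proof (induction C)
  case empty
  then show ?case using computable_const[of n False] by simp
next
  case (insert a C)
  have IH: "computable n (\<lambda>x. \<exists>w\<in>C. f w x) (1 + card C * l)"
    by (rule insert.IH) (use insert.prems in \<open>blast+\<close>)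
  have "computable n (\<lambda>x. f a x \<noteq> (\<exists>w\<in>C. f w x)) (l + (1 + card C * l))"
    by (rule computable_xor[OF _ IH]) (use insert.prems in blast)
  then have "computable n (\<lambda>x. \<exists>w\<in>insert a C. f w x) (l + (1 + card C * l))"
    by (rule computable_cong[rotated]) (use insert.prems(2) insert.hyps(2) in blast)
  then show ?case using insert.hyps by (simp add: add.assoc add.left_commute)
qed

text \<open>Repeated squaring: determinism makes the midpoint after \<open>2 ^ k\<close> steps
  unique, so \<open>computable_ex\<close> applies. A program length \<open>m\<close> grows to
  \<open>1 + 4 * card C * m\<close>, and the 1 is absorbed into a fifth copy of
  \<open>card C * m\<close>.\<close>

lemma computable_funpow:
  fixes F :: "bool list \<Rightarrow> 'c \<Rightarrow> 'c"
  assumes fin: "finite C"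
    and closed: "\<And>x u. length x = n \<Longrightarrow> u \<in> C \<Longrightarrow> F x u \<in> C"
    and base: "\<And>u v. u \<in> C \<Longrightarrow> v \<in> C \<Longrightarrow> computable n (\<lambda>x. F x u = v) l"
    and l: "1 \<le> l"
    and uv: "u \<in> C" "v \<in> C"
  shows "computable n (\<lambda>x. (F x ^^ 2 ^ k) u = v) ((5 * card C) ^ k * l)"
  using uv
proof (induction k arbitrary: u v)
  case 0
  then show ?case using base by simp
next
  case (Suc k)
  let ?l = "(5 * card C) ^ k * l"
  have pos: "1 \<le> card C" using Suc.prems fin by (metis card_0_eq empty_iff not_less_eq_eq One_nat_def le_zero_eq)
  then have "1 \<le> (5 * card C) ^ k" by (intro one_le_power) auto
  then have pos': "1 \<le> card C * ?l" using pos l by (metis mult_le_mono mult_1)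
  have in_C: "(F x ^^ t) w \<in> C" if "length x = n" "w \<in> C" for x w t
    by (induction t) (use that closed in auto)
  have "computable n (\<lambda>x. \<exists>w\<in>C. (F x ^^ 2 ^ k) u = w \<and> (F x ^^ 2 ^ k) w = v)
      (1 + card C * (2 * (?l + ?l)))"
    by (rule computable_ex[OF fin computable_and[OF Suc.IH Suc.IH]]) (use Suc.prems in auto)
  then have "computable n (\<lambda>x. (F x ^^ 2 ^ Suc k) u = v) (1 + card C * (2 * (?l + ?l)))"
    by (rule computable_cong[rotated])
      (use in_C Suc.prems in \<open>auto simp: mult_2 funpow_add\<close>)
  then show ?case
    by (rule computable_mono) (use pos' in \<open>simp add: algebra_simps\<close>)
qed

subsection \<open>Configuration graphs\<close>

text \<open>This locality of a step from a fixed configuration is what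
  \<open>computable_local\<close> asks for; the length matters only through the clamp of the input
  head.\<close>

lemma step_cong:
  assumes "length x = length y" "tape_sym x (c_ipos u) = tape_sym y (c_ipos u)"
  shows "step M x adv u = step M y adv u"
  using assms by (simp add: step_def move_ro_def)

text \<open>Work tapes are total functions; prescribing blanks from cell \<open>s\<close> on makes
  the set finite. \<open>A\<close> stands for the advice length.\<close>

definition confs :: "tm \<Rightarrow> nat \<Rightarrow> nat \<Rightarrow> nat \<Rightarrow> conf set" where
  "confs M n A s = (\<lambda>(q, i, r, w, p). Conf q i r w p) `
     ({..<tm_nstates M} \<times> {..n + 1} \<times> {..A + 1} \<times>
      {w. (\<forall>j<s. w j < tm_nsyms M) \<and> (\<forall>j\<ge>s. w j = 0)} \<times> {..<s})"

lemma confs_iff: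
  "Conf q i r w p \<in> confs M n A s \<longleftrightarrow> q < tm_nstates M \<and> i \<le> n + 1 \<and> r \<le> A + 1 \<and>
     (\<forall>j<s. w j < tm_nsyms M) \<and> (\<forall>j\<ge>s. w j = 0) \<and> p < s"
  unfolding confs_def by (auto intro!: image_eqI[where x = "(q, i, r, w, p)"])

lemma finite_card_bounded_functions:
  fixes g s :: nat
  defines "W \<equiv> {w :: nat \<Rightarrow> nat. (\<forall>j<s. w j < g) \<and> (\<forall>j\<ge>s. w j = 0)}"
  shows "finite W \<and> card W \<le> g ^ s"
proof -
  let ?L = "{xs. set xs \<subseteq> {..<g} \<and> length xs = s}"
  have fin: "finite ?L" by (rule finite_lists_length_eq) simp
  have "W \<subseteq> (\<lambda>xs j. if j < s then xs ! j else 0) ` ?L"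
  proof
    fix w assume w: "w \<in> W"
    have "w = (\<lambda>j. if j < s then map w [0..<s] ! j else 0)"
      using w by (auto simp: W_def fun_eq_iff)
    moreover have "map w [0..<s] \<in> ?L" using w by (auto simp: W_def)
    ultimately show "w \<in> (\<lambda>xs j. if j < s then xs ! j else 0) ` ?L" by blast
  qed
  then have "finite W" "card W \<le> card ?L"
    using finite_surj[OF fin] surj_card_le[OF fin] by blast+
  then show ?thesis using card_lists_length_eq[of "{..<g}" s] by simp
qed

lemma finite_confs: "finite (confs M n A s)"
  unfolding confs_def using finite_card_bounded_functions[of s "tm_nsyms M"]
  by (intro finite_imageI finite_cartesian_product) auto

lemma card_confs:
  "card (confs M n A s) \<le> tm_nstates M * ((n + 2) * ((A + 2) * (tm_nsyms M ^ s * s)))"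
proof -
  let ?W = "{w. (\<forall>j<s. w j < tm_nsyms M) \<and> (\<forall>j\<ge>s. w j = (0::nat))}"
  have W: "finite ?W" "card ?W \<le> tm_nsyms M ^ s"
    using finite_card_bounded_functions[of s "tm_nsyms M"] by auto
  have "card (confs M n A s) \<le> card ({..<tm_nstates M} \<times> {..n + 1} \<times> {..A + 1} \<times> ?W \<times> {..<s})"
    unfolding confs_def using W by (intro card_image_le finite_cartesian_product) auto
  also have "\<dots> = tm_nstates M * ((n + 2) * ((A + 2) * (card ?W * s)))"
    by (simp add: card_cartesian_product)
  also have "\<dots> \<le> tm_nstates M * ((n + 2) * ((A + 2) * (tm_nsyms M ^ s * s)))"
    using W(2) by (intro mult_le_mono le_refl)
  finally show ?thesis .
qed

text \<open>Only the work head could leave the set: the read-only heads are clamped, and the one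
  written cell lies below \<open>s\<close>.\<close>

lemma step_in_confs:
  assumes M: "wf_tm M" and u: "u \<in> confs M (length x) (length adv) s"
    and space: "c_wpos (step M x adv u) < s"
  shows "step M x adv u \<in> confs M (length x) (length adv) s"
proof -
  obtain q i r w p where u_eq: "u = Conf q i r w p" by (cases u)
  have u': "q < tm_nstates M" "i \<le> length x + 1" "r \<le> length adv + 1"
    "\<forall>j<s. w j < tm_nsyms M" "\<forall>j\<ge>s. w j = 0" "p < s"
    using u by (auto simp: u_eq confs_iff)
  have sym: "tape_sym z m < 4" for z m by (simp add: tape_sym_def)
  show ?thesis
  proof (cases "q = tm_acc M \<or> q = tm_rej M")
    case True
    then show ?thesis using u by (simp add: step_def u_eq)
  next
    case False
    obtain q' g di da dw where
      d: "tm_delta M q (tape_sym x i) (tape_sym adv r) (w p) = (q', g, di, da, dw)"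
      by (cases "tm_delta M q (tape_sym x i) (tape_sym adv r) (w p)")
    have "case tm_delta M q (tape_sym x i) (tape_sym adv r) (w p) of (q', g', di, da, dw) \<Rightarrow>
        q' < tm_nstates M \<and> g' < tm_nsyms M \<and> is_move di \<and> is_move da \<and> is_move dw"
      using M u'(1,4,6) sym unfolding wf_tm_def by (elim conjE) simp
    then have g: "q' < tm_nstates M" "g < tm_nsyms M" by (simp_all add: d)
    have eq: "step M x adv u =
        Conf q' (move_ro x i di) (move_ro adv r da) (w(p := g)) (move_work p dw)"
      using False by (simp add: step_def u_eq d)
    moreover have "move_work p dw < s" using space by (simp add: eq)
    moreover have "move_ro x i di \<le> length x + 1" "move_ro adv r da \<le> length adv + 1"
      by (simp_all add: move_ro_def)
    ultimately show ?thesis using g u'(4-6) by (simp add: confs_iff)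
  qed
qed

section \<open>Runs and the time bound for acceptance\<close>

lemma run_Suc: "run M x adv (Suc t) = step M x adv (run M x adv t)"
  by (simp add: run_def)

lemma run_add: "run M x adv (t + d) = (step M x adv ^^ d) (run M x adv t)"
  by (simp add: run_def funpow_add add.commute[of t d])

lemma run_halted:
  assumes "c_state (run M x adv t) = tm_acc M \<or> c_state (run M x adv t) = tm_rej M" "t \<le> t'"
  shows "run M x adv t' = run M x adv t"
  using assms(2) by (induction t' rule: dec_induct) (use assms(1) in \<open>auto simp: run_Suc step_def\<close>)

lemma run_in_confs:
  assumes M: "wf_tm M" and space: "\<And>t. c_wpos (run M x adv t) < s"
  shows "run M x adv t \<in> confs M (length x) (length adv) s"
proof (induction t)
  case 0
  then show ?case using M space[of 0] by (auto simp: run_def init_conf_def confs_iff wf_tm_def)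
next
  case (Suc t)
  then show ?case using step_in_confs[OF M Suc] space[of "Suc t"] by (simp add: run_Suc)
qed

text \<open>Pigeonhole: the configurations up to the first accepting time are pairwise distinct, so
  that time is below \<open>card C\<close>; from then on the run stands still.\<close>

lemma accepts_iff_run_bounded:
  assumes fin: "finite C" and C: "\<And>t. run M x adv t \<in> C" and T: "card C \<le> T"
  shows "accepts M x adv \<longleftrightarrow> c_state (run M x adv T) = tm_acc M"
proof
  assume "accepts M x adv"
  then obtain t where t: "c_state (run M x adv t) = tm_acc M"
    and least: "\<And>t'. t' < t \<Longrightarrow> c_state (run M x adv t') \<noteq> tm_acc M"
    unfolding accepts_def using exists_least_iff[of "\<lambda>t. c_state (run M x adv t) = tm_acc M"] by metis
  have "inj_on (run M x adv) {..t}"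
  proof (rule linorder_inj_onI)
    fix a b assume ab: "a < b" "a \<in> {..t}" "b \<in> {..t}"
    show "run M x adv a \<noteq> run M x adv b"
    proof
      assume eq: "run M x adv a = run M x adv b"
      \<comment> \<open>A repetition could be cut out: continuing from time \<open>a\<close> as from
        time \<open>b\<close> accepts earlier than \<open>t\<close>.\<close>
      have "run M x adv (a + (t - b)) = run M x adv t"
        using eq ab run_add[of M x adv a "t - b"] run_add[of M x adv b "t - b"] by simp
      moreover have "a + (t - b) < t" using ab by auto
      ultimately show False using least[of "a + (t - b)"] t by simp
    qed
  qed auto
  then have "card {..t} \<le> card C" by (rule card_inj_on_le) (use C fin in auto)
  then have "t \<le> T" using T by simp
  then show "c_state (run M x adv T) = tm_acc M" using run_halted[of M x adv t T] t by simp
qed (auto simp: accepts_def)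

text \<open>\<open>2 ^ k\<close> bounds the number of configurations, hence is also enough steps,
  and is reached by \<open>k\<close> doublings. Acceptance is then a disjunction over accepting
  configurations, of which determinism allows only one at that time.\<close>

lemma computable_accepts:
  assumes M: "wf_tm M" and s: "0 < s"
    and space: "\<And>x t. length x = n \<Longrightarrow> c_wpos (run M x adv t) < s"
    and N: "card (confs M n (length adv) s) \<le> 2 ^ k"
  shows "computable n (\<lambda>x. accepts M x adv) (1 + 2 ^ k * ((5 * 2 ^ k) ^ k * (2 * n + 4)))"
proof -
  let ?C = "confs M n (length adv) s"
  let ?D = "{v \<in> ?C. c_state v = tm_acc M}"
  let ?l = "(5 * card ?C) ^ k * (2 * n + 4)"
  \<comment> \<open>Members of \<open>?C\<close> that no run visits may step out of
    \<open>?C\<close>. \<open>F\<close> leaves these fixed, so \<open>?C\<close> is closed under it,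
    and it agrees with \<open>step\<close> along actual runs.\<close>
  define F where "F x u = (if step M x adv u \<in> ?C then step M x adv u else u)" for x u
  have init: "init_conf M \<in> ?C" using M s by (auto simp: init_conf_def confs_iff wf_tm_def)
  have in_C: "run M x adv t \<in> ?C" if "length x = n" for x t
    using run_in_confs[OF M space] that by blast
  have F_run: "(F x ^^ t) (init_conf M) = run M x adv t" if "length x = n" for x t
  proof (induction t)
    case (Suc t)
    then show ?case using in_C[OF that, of "Suc t"] by (simp add: F_def run_Suc)
  qed (simp add: run_def)
  have base: "computable n (\<lambda>x. F x u = v) (2 * n + 4)" if "u \<in> ?C" for u v
  proof (rule computable_local)
    show "c_ipos u \<le> n + 1" using that by (cases u) (auto simp: confs_iff)
  next
    fix x y assume "length x = n" "length y = n"
      "tape_sym x (c_ipos u) = tape_sym y (c_ipos u)" "F x u = v"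
    then show "F y u = v" using step_cong[of x y u M adv] by (simp add: F_def split: if_splits)
  qed
  have "computable n (\<lambda>x. \<exists>v\<in>?D. (F x ^^ 2 ^ k) (init_conf M) = v) (1 + card ?D * ?l)"
  proof (rule computable_ex)
    show "computable n (\<lambda>x. (F x ^^ 2 ^ k) (init_conf M) = v) ?l" if "v \<in> ?D" for v
      by (rule computable_funpow[OF finite_confs _ base]) (use that init in \<open>auto simp: F_def\<close>)
  qed (auto simp: finite_confs)
  then have "computable n (\<lambda>x. accepts M x adv) (1 + card ?D * ?l)"
  proof (rule computable_cong[rotated])
    fix x :: "bool list" assume x: "length x = n"
    show "(\<exists>v\<in>?D. (F x ^^ 2 ^ k) (init_conf M) = v) = accepts M x adv"
      unfolding F_run[OF x] using accepts_iff_run_bounded[OF finite_confs in_C[OF x] N] in_C[OF x] by auto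
  qed
  moreover have "1 + card ?D * ?l \<le> 1 + 2 ^ k * ((5 * 2 ^ k) ^ k * (2 * n + 4))"
    using N card_mono[of ?C ?D] finite_confs
    by (intro add_left_mono mult_le_mono power_mono order.trans[OF card_mono[of ?C ?D] N]) auto
  ultimately show ?thesis by (rule computable_mono)
qed

subsection \<open>Polylogarithmic and quasipolynomial growth\<close>

text \<open>From \<open>n = 3\<close> on the logarithm exceeds 1 by a fixed amount, so constant
  factors and summands are absorbed into the exponent \<open>d\<close>.\<close>

definition polylog :: "(nat \<Rightarrow> real) \<Rightarrow> bool" where
  "polylog f \<longleftrightarrow> (\<exists>d::nat. \<forall>n\<ge>3. f n \<le> log 2 (real n) ^ d)"

definition quasipoly :: "(nat \<Rightarrow> real) \<Rightarrow> bool" where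
  "quasipoly f \<longleftrightarrow> (\<exists>d::nat. \<forall>n\<ge>3. f n \<le> 2 powr (log 2 (real n) ^ d))"

text \<open>From \<open>2 ^ 3 \<le> 3 ^ 2\<close>.\<close>

lemma log2_ge_three_halves:
  assumes "n \<ge> (3::nat)"
  shows "log 2 (real n) \<ge> 3 / 2"
proof -
  have "3 = log 2 (2 ^ 3)" by (subst log_nat_power) auto
  also have "\<dots> \<le> log 2 (3 ^ 2)" by (subst log_le_cancel_iff) auto
  also have "\<dots> = 2 * log 2 3" by (subst log_nat_power) auto
  also have "\<dots> \<le> 2 * log 2 (real n)" using assms by simp
  finally show ?thesis by simp
qed

text \<open>The extra exponent 2 pays for a factor 2, as \<open>(3 / 2) ^ 2 \<ge> 2\<close>.\<close>

lemma sum_le_power_max: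
  fixes L :: real
  assumes "L \<ge> 3 / 2"
  shows "L ^ d + L ^ e \<le> L ^ (max d e + 2)"
proof -
  have "2 \<le> (3 / 2 :: real) ^ 2" by (simp add: power2_eq_square)
  also have "\<dots> \<le> L ^ 2" using assms by (intro power_mono) auto
  finally have 2: "2 \<le> L ^ 2" .
  have "L ^ d + L ^ e \<le> L ^ max d e + L ^ max d e"
    using assms by (intro add_mono power_increasing) auto
  also have "\<dots> = 2 * L ^ max d e" by simp
  also have "\<dots> \<le> L ^ 2 * L ^ max d e"
    using 2 assms by (intro mult_right_mono) auto
  finally show ?thesis by (simp only: power_add mult.commute)
qed

lemma polylog_mono: "polylog g \<Longrightarrow> (\<And>n. n \<ge> 3 \<Longrightarrow> f n \<le> g n) \<Longrightarrow> polylog f"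
  unfolding polylog_def by (meson order.trans)

lemma quasipoly_mono: "quasipoly g \<Longrightarrow> (\<And>n. n \<ge> 3 \<Longrightarrow> f n \<le> g n) \<Longrightarrow> quasipoly f"
  unfolding quasipoly_def by (meson order.trans)

lemma polylog_log: "polylog (\<lambda>n. log 2 (real n))"
  unfolding polylog_def by (intro exI[of _ 1]) simp

lemma polylog_const: "polylog (\<lambda>n. c)"
proof -
  obtain d where d: "c < (3 / 2) ^ d" using real_arch_pow[of "3 / 2" c] by auto
  have "c \<le> log 2 (real n) ^ d" if "n \<ge> 3" for n
    using d power_mono[OF log2_ge_three_halves[OF that], of d] by simp
  then show ?thesis unfolding polylog_def by blast
qed

lemma polylog_add:
  assumes "polylog f" "polylog g"
  shows "polylog (\<lambda>n. f n + g n)"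
proof -
  obtain d e where de: "\<And>n. n \<ge> 3 \<Longrightarrow> f n \<le> log 2 (real n) ^ d" "\<And>n. n \<ge> 3 \<Longrightarrow> g n \<le> log 2 (real n) ^ e"
    using assms unfolding polylog_def by blast
  have "f n + g n \<le> log 2 (real n) ^ (max d e + 2)" if "n \<ge> 3" for n
    using add_mono[OF de(1)[OF that] de(2)[OF that]] sum_le_power_max[OF log2_ge_three_halves[OF that], of d e] by simp
  then show ?thesis unfolding polylog_def by blast
qed

lemma polylog_mult:
  assumes "polylog f" "polylog g" "\<And>n. n \<ge> 3 \<Longrightarrow> 0 \<le> g n"
  shows "polylog (\<lambda>n. f n * g n)"
proof -
  obtain d e where de: "\<And>n. n \<ge> 3 \<Longrightarrow> f n \<le> log 2 (real n) ^ d" "\<And>n. n \<ge> 3 \<Longrightarrow> g n \<le> log 2 (real n) ^ e"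
    using assms(1,2) unfolding polylog_def by blast
  have "f n * g n \<le> log 2 (real n) ^ (d + e)" if "n \<ge> 3" for n
    unfolding power_add using de assms(3) that log2_ge_three_halves[OF that]
    by (intro mult_mono) auto
  then show ?thesis unfolding polylog_def by blast
qed

lemma polylog_power:
  assumes "polylog f" "\<And>n. n \<ge> 3 \<Longrightarrow> 0 \<le> f n"
  shows "polylog (\<lambda>n. f n ^ c)"
proof (induction c)
  case 0
  then show ?case using polylog_const[of 1] by simp
next
  case (Suc c)
  then show ?case using polylog_mult[OF assms(1) Suc] assms(2) by simp
qed

text \<open>Exponents add in a product. Both bounds are at least 2, so their sum is at most their
  product and the same bound serves.\<close>

lemma quasipoly_add_mult:
  assumes "quasipoly f" "quasipoly g"
  shows "quasipoly (\<lambda>n. f n + g n)"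
    and "(\<And>n. n \<ge> 3 \<Longrightarrow> 0 \<le> g n) \<Longrightarrow> quasipoly (\<lambda>n. f n * g n)"
proof -
  obtain d e where de: "\<And>n. n \<ge> 3 \<Longrightarrow> f n \<le> 2 powr (log 2 (real n) ^ d)"
      "\<And>n. n \<ge> 3 \<Longrightarrow> g n \<le> 2 powr (log 2 (real n) ^ e)"
    using assms unfolding quasipoly_def by blast
  have prod: "2 powr (log 2 (real n) ^ d) * 2 powr (log 2 (real n) ^ e)
      \<le> 2 powr (log 2 (real n) ^ (max d e + 2))" if "n \<ge> 3" for n
    unfolding powr_add[symmetric]
    using sum_le_power_max[OF log2_ge_three_halves[OF that]] by simp
  show "quasipoly (\<lambda>n. f n * g n)" if nonneg: "\<And>n. n \<ge> 3 \<Longrightarrow> 0 \<le> g n"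
  proof -
    have "f n * g n \<le> 2 powr (log 2 (real n) ^ (max d e + 2))" if "n \<ge> 3" for n
      using mult_mono[OF de(1)[OF that] de(2)[OF that]] nonneg[OF that] prod[OF that] by simp
    then show ?thesis unfolding quasipoly_def by blast
  qed
  have sum: "a + b \<le> a * b" if "a \<ge> 2" "b \<ge> 2" for a b :: real
    using mult_mono[of 1 "a - 1" 1 "b - 1"] that by (simp add: algebra_simps)
  have ge2: "2 \<le> 2 powr (log 2 (real n) ^ m)" if "n \<ge> 3" for n m
  proof -
    have "1 \<le> log 2 (real n) ^ m" using log2_ge_three_halves[OF that] by (intro one_le_power) simp
    then show ?thesis using powr_mono[of 1 "log 2 (real n) ^ m" 2] by simp
  qed
  have "f n + g n \<le> 2 powr (log 2 (real n) ^ (max d e + 2))" if "n \<ge> 3" for n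
    using de(1)[OF that] de(2)[OF that] sum[OF ge2 ge2, OF that that, of d e] prod[OF that] by linarith
  then show "quasipoly (\<lambda>n. f n + g n)" unfolding quasipoly_def by blast
qed

lemmas quasipoly_add = quasipoly_add_mult(1)
  and quasipoly_mult = quasipoly_add_mult(2)

text \<open>With \<open>L = log 2 n\<close> and \<open>k \<le> L ^ e\<close>, the power
  \<open>(2 powr (L ^ d)) ^ k\<close> is at most \<open>2 powr (L ^ (d + e))\<close>. This keeps the
  program quasipolynomial through all doublings.\<close>

lemma quasipoly_power:
  assumes "quasipoly f" "polylog (\<lambda>n. real (k n))" "\<And>n. n \<ge> 3 \<Longrightarrow> 0 \<le> f n"
  shows "quasipoly (\<lambda>n. f n ^ k n)"
proof -
  obtain d e where de: "\<And>n. n \<ge> 3 \<Longrightarrow> f n \<le> 2 powr (log 2 (real n) ^ d)"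
      "\<And>n. n \<ge> 3 \<Longrightarrow> real (k n) \<le> log 2 (real n) ^ e"
    using assms(1,2) unfolding quasipoly_def polylog_def by blast
  have "f n ^ k n \<le> 2 powr (log 2 (real n) ^ (d + e))" if n: "n \<ge> 3" for n
  proof -
    have "f n ^ k n \<le> (2 powr (log 2 (real n) ^ d)) ^ k n"
      using de(1) assms(3) n by (intro power_mono) auto
    also have "\<dots> = 2 powr (log 2 (real n) ^ d * real (k n))"
      by (simp add: powr_powr powr_realpow[symmetric])
    also have "\<dots> \<le> 2 powr (log 2 (real n) ^ d * log 2 (real n) ^ e)"
      using de(2)[OF n] log2_ge_three_halves[OF n] by (intro powr_mono mult_left_mono) auto
    finally show ?thesis by (simp add: power_add)
  qed
  then show ?thesis unfolding quasipoly_def by blast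
qed

lemma quasipoly_exp:
  assumes "polylog h"
  shows "quasipoly (\<lambda>n. 2 powr h n)"
  using assms unfolding polylog_def quasipoly_def by simp

lemma quasipoly_const: "quasipoly (\<lambda>n. c)"
proof (rule quasipoly_mono)
  show "quasipoly (\<lambda>n. 2 powr (log 2 (max 1 c)))"
    by (rule quasipoly_exp[OF polylog_const])
  show "c \<le> 2 powr (log 2 (max 1 c))" by simp
qed

lemma quasipoly_of_nat: "quasipoly real"
  by (rule quasipoly_mono[OF quasipoly_exp[OF polylog_log]]) simp

lemma quasipoly_polylog:
  assumes "polylog (\<lambda>n. real (s n))"
  shows "quasipoly (\<lambda>n. real (s n))"
proof (rule quasipoly_mono)
  show "quasipoly (\<lambda>n. 2 ^ s n)"
    by (rule quasipoly_power[OF quasipoly_const assms]) simp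
  show "real (s n) \<le> 2 ^ s n" for n
    using of_nat_less_two_power[of "s n", where 'a = real] by simp
qed

text \<open>Supplies the number of doublings, namely the exponent of the quasipolynomial bound
  rounded up.\<close>

lemma quasipoly_le_power2:
  assumes "quasipoly (\<lambda>n. real (N n))"
  obtains k where "polylog (\<lambda>n. real (k n))" "\<And>n. n \<ge> 3 \<Longrightarrow> N n \<le> 2 ^ k n"
proof -
  obtain d where d: "\<And>n. n \<ge> 3 \<Longrightarrow> real (N n) \<le> 2 powr (log 2 (real n) ^ d)"
    using assms unfolding quasipoly_def by blast
  define k where "k n = nat \<lceil>log 2 (real n) ^ d\<rceil>" for n
  have nonneg: "0 \<le> log 2 (real n) ^ d" if "n \<ge> 3" for n
    using log2_ge_three_halves[OF that] by simp
  have "polylog (\<lambda>n. log 2 (real n) ^ d + 1)"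
    by (intro polylog_add polylog_const) (auto simp: polylog_def)
  then have "polylog (\<lambda>n. real (k n))"
  proof (rule polylog_mono)
    show "real (k n) \<le> log 2 (real n) ^ d + 1" if "n \<ge> 3" for n
      using nonneg[OF that] unfolding k_def by linarith
  qed
  moreover have "N n \<le> 2 ^ k n" if "n \<ge> 3" for n
  proof -
    have "real (N n) \<le> 2 powr real (k n)"
      unfolding k_def using d[OF that] by (rule order.trans) (intro powr_mono real_nat_ceiling_ge, simp)
    then have "real (N n) \<le> real (2 ^ k n)" by (simp add: powr_realpow)
    then show ?thesis by (simp only: of_nat_le_iff)
  qed
  ultimately show thesis by (rule that)
qed

lemma qp_advice_quasipoly:
  assumes "qp_advice a"
  shows "quasipoly (\<lambda>n. real (length (a n)))"
proof -
  obtain c :: real where c: "\<And>n. n \<ge> 1 \<Longrightarrow> real (length (a n)) \<le> 2 powr (log 2 (real n) powr c)"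
    using assms unfolding qp_advice_def by blast
  have "real (length (a n)) \<le> 2 powr (log 2 (real n) ^ nat \<lceil>c\<rceil>)" if n: "n \<ge> 3" for n
  proof -
    have L: "log 2 (real n) \<ge> 3 / 2" by (rule log2_ge_three_halves[OF n])
    have "log 2 (real n) powr c \<le> log 2 (real n) powr real (nat \<lceil>c\<rceil>)"
      using L by (intro powr_mono real_nat_ceiling_ge) auto
    also have "\<dots> = log 2 (real n) ^ nat \<lceil>c\<rceil>" using L by (intro powr_realpow) auto
    finally have "2 powr (log 2 (real n) powr c) \<le> 2 powr (log 2 (real n) ^ nat \<lceil>c\<rceil>)"
      by (intro powr_mono) auto
    then show ?thesis using c[of n] n by linarith
  qed
  then show ?thesis unfolding quasipoly_def by blast
qed

text \<open>Empty strings meet the bound at lengths 1 and 2 for every exponent;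
  \<open>qp_advice\<close> says nothing about length 0.\<close>

lemma qp_adviceI:
  assumes "quasipoly (\<lambda>n. real (length (a n)))" "a 1 = []" "a 2 = []"
  shows "qp_advice a"
proof -
  obtain d where d: "\<And>n. n \<ge> 3 \<Longrightarrow> real (length (a n)) \<le> 2 powr (log 2 (real n) ^ d)"
    using assms(1) unfolding quasipoly_def by blast
  have "real (length (a n)) \<le> 2 powr (log 2 (real n) powr real d)" if "n \<ge> 1" for n :: nat
  proof -
    consider "n = 1" | "n = 2" | "n \<ge> 3" using \<open>n \<ge> 1\<close> by force
    then show ?thesis
    proof cases
      case 3
      then show ?thesis using d[OF 3] log2_ge_three_halves[OF 3] by (simp add: powr_realpow)
    qed (use assms(2,3) in simp_all)
  qed
  then show ?thesis unfolding qp_advice_def by blast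
qed

subsection \<open>A constant space interpreter\<close>

lemma tape_sym_simps:
  "tape_sym w 0 = 0"
  "tape_sym (pre @ b # post) (Suc (length pre)) = (if b then 3 else 2)"
  "tape_sym w (Suc (length w)) = 1"
  by (auto simp: tape_sym_def)

lemma move_ro_simps:
  "move_ro w i 0 = min (Suc (length w)) i"
  "move_ro w i 1 = min (Suc (length w)) (Suc i)"
  by (auto simp: move_ro_def)

text \<open>\<open>Scan\<close> holds the input bits read so far; \<open>Main\<close> holds the
  registers and the number of ones counted in the opcode being decoded.\<close>

datatype ctrl = Scan "bool list" | Main "nat \<Rightarrow> bool" nat | Accept | Reject

text \<open>\<open>Scan\<close> finds out whether a third input bit exists; if not, \<open>H\<close>
  decides. In \<open>Main\<close>, advice bits 1 (symbol 3) are counted, a bit 0 executes the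
  counted opcode, and the right endmarker ends the program with the answer in register 1. The cap
  19, the largest opcode, keeps the count bounded on arbitrary advice.\<close>

fun ctrl_step :: "bool list set \<Rightarrow> ctrl \<Rightarrow> nat \<Rightarrow> nat \<Rightarrow> ctrl \<times> int \<times> int" where
  "ctrl_step H (Scan w) i a =
     (if i = 0 then (Scan w, 1, 0)
      else if i = 1 then (if w \<in> H then Accept else Reject, 0, 0)
      else if length w < 2 then (Scan (w @ [i = 3]), 1, 0)
      else (Main (\<lambda>r. r = 0) 0, 0, 0))"
| "ctrl_step H (Main R k) i a =
     (if a = 0 then (Main R k, 0, 1)
      else if a = 1 then (if R 1 then Accept else Reject, 0, 0)
      else if a = 3 then (Main R (min 19 (k + 1)), 0, 1)
      else (Main (op_upd i k R) 0, op_dir k, 1))"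
| "ctrl_step H s i a = (s, 0, 0)"

definition ctrls :: "ctrl set" where
  "ctrls = Scan ` {w. length w \<le> 2} \<union>
     case_prod Main ` ({R. \<forall>i\<ge>3. \<not> R i} \<times> {..19}) \<union> {Accept, Reject}"

lemma ctrls_iff:
  "Scan w \<in> ctrls \<longleftrightarrow> length w \<le> 2"
  "Main R k \<in> ctrls \<longleftrightarrow> (\<forall>i\<ge>3. \<not> R i) \<and> k \<le> 19"
  "Accept \<in> ctrls" "Reject \<in> ctrls"
  by (auto simp: ctrls_def intro!: image_eqI[where x = "(R, k)"])

lemma finite_ctrls: "finite ctrls"
proof -
  have "finite {w :: bool list. length w \<le> 2}"
    using finite_lists_length_le[of "UNIV :: bool set" 2] by simp
  moreover have "{R :: nat \<Rightarrow> bool. \<forall>i\<ge>3. \<not> R i} \<subseteq> (\<lambda>A i. i \<in> A) ` Pow {..<3}"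
  proof
    fix R :: "nat \<Rightarrow> bool" assume R: "R \<in> {R. \<forall>i\<ge>3. \<not> R i}"
    have "{i. R i} \<in> Pow {..<3}" using R by (auto simp: not_le[symmetric])
    then show "R \<in> (\<lambda>A i. i \<in> A) ` Pow {..<3}" by (intro image_eqI[where x = "{i. R i}"]) auto
  qed
  then have "finite {R :: nat \<Rightarrow> bool. \<forall>i\<ge>3. \<not> R i}"
    by (rule finite_subset) simp
  ultimately show ?thesis unfolding ctrls_def by simp
qed

lemma op_upd_bounded: "\<forall>i\<ge>3. \<not> R i \<Longrightarrow> \<forall>i\<ge>3. \<not> op_upd s k R i"
  by (auto simp: op_upd_def Let_def)

lemma ctrl_step_in_ctrls:
  assumes "s \<in> ctrls" "ctrl_step H s i a = (s', di, da)"
  shows "s' \<in> ctrls \<and> is_move di \<and> is_move da"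
  using assms
  by (cases s) (auto simp: ctrls_iff is_move_def op_dir_def op_upd_bounded split: if_splits)

text \<open>States of a \<open>tm\<close> form an initial segment of the naturals, so some
  enumeration of \<open>ctrls\<close> is fixed.\<close>

definition code :: "ctrl \<Rightarrow> nat" where
  "code = (SOME e. bij_betw e ctrls {0..<card ctrls})"

lemma bij_code: "bij_betw code ctrls {0..<card ctrls}"
  unfolding code_def using ex_bij_betw_finite_nat[OF finite_ctrls] by (rule someI_ex)

lemma code_less: "s \<in> ctrls \<Longrightarrow> code s < card ctrls"
  using bij_code by (auto simp: bij_betw_def)

lemma inj_code: "inj_on code ctrls"
  using bij_code by (simp add: bij_betw_def)

lemma code_halting_distinct: "code Accept \<noteq> code Reject"
  using inj_onD[OF inj_code, of Accept Reject] by (auto simp: ctrls_iff)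

definition interpreter :: "bool list set \<Rightarrow> tm" where
  "interpreter H = TM (card ctrls) 1 (code (Scan [])) (code Accept) (code Reject)
     (\<lambda>q i a g. case ctrl_step H (inv_into ctrls code q) i a of (s, di, da) \<Rightarrow> (code s, 0, di, da, 0))"

lemma wf_interpreter: "wf_tm (interpreter H)"
proof -
  have "code s < card ctrls \<and> is_move di \<and> is_move da"
    if "ctrl_step H (inv_into ctrls code q) i a = (s, di, da)" "q < card ctrls" for q i a s di da
  proof -
    have "q \<in> code ` ctrls" using bij_code that(2) by (simp add: bij_betw_def)
    then have "inv_into ctrls code q \<in> ctrls" by (rule inv_into_into)
    then show ?thesis using ctrl_step_in_ctrls[OF _ that(1)] code_less by blast
  qed
  moreover have "is_move 0" by (simp add: is_move_def)
  ultimately show ?thesis using code_halting_distinct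
    by (auto simp: wf_tm_def interpreter_def code_less ctrls_iff split: prod.split)
qed

definition conf_of :: "ctrl \<Rightarrow> nat \<Rightarrow> nat \<Rightarrow> conf" where
  "conf_of s i r = Conf (code s) i r (\<lambda>_. 0) 0"

text \<open>Injectivity of \<open>code\<close> lets steps be computed on \<open>ctrl\<close> values,
  without knowing the chosen enumeration.\<close>

lemma step_conf_of:
  assumes s: "s \<in> ctrls"
  shows "step (interpreter H) x adv (conf_of s i r) =
     (if s = Accept \<or> s = Reject then conf_of s i r
      else case ctrl_step H s (tape_sym x i) (tape_sym adv r) of
        (s', di, da) \<Rightarrow> conf_of s' (move_ro x i di) (move_ro adv r da))"
proof -
  have "code s = code s' \<longleftrightarrow> s = s'" if "s' \<in> ctrls" for s'
    using inj_code s that by (auto simp: inj_on_def)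
  moreover have "inv_into ctrls code (code s) = s" using inj_code s by simp
  ultimately show ?thesis
    by (auto simp: step_def conf_of_def interpreter_def ctrls_iff move_work_def fun_eq_iff
        split: prod.split)
qed

lemma run_conf_of: "\<exists>s\<in>ctrls. \<exists>i r. run (interpreter H) x adv t = conf_of s i r"
proof (induction t)
  case 0
  then show ?case
    by (intro bexI[of _ "Scan []"]) (auto simp: run_def init_conf_def conf_of_def interpreter_def ctrls_iff)
next
  case (Suc t)
  then obtain s i r where s: "s \<in> ctrls" "run (interpreter H) x adv t = conf_of s i r" by blast
  obtain s' di da where s': "ctrl_step H s (tape_sym x i) (tape_sym adv r) = (s', di, da)"
    by (cases "ctrl_step H s (tape_sym x i) (tape_sym adv r)")
  then have "s' \<in> ctrls" using ctrl_step_in_ctrls[OF s(1)] by blast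
  then show ?case using s s' by (auto simp: run_Suc step_conf_of)
qed

lemma space_interpreter: "space_within (interpreter H) x adv 1"
  unfolding space_within_def
proof
  fix t
  obtain s i r where "run (interpreter H) x adv t = conf_of s i r" using run_conf_of by blast
  then show "real (c_wpos (run (interpreter H) x adv t) + 1) \<le> 1" by (simp add: conf_of_def)
qed

section \<open>Reachability and correctness of the interpreter\<close>

definition leads :: "tm \<Rightarrow> bool list \<Rightarrow> bool list \<Rightarrow> conf \<Rightarrow> conf \<Rightarrow> bool" where
  "leads M x adv c c' \<longleftrightarrow> (\<exists>t. (step M x adv ^^ t) c = c')"

lemma leads_refl: "leads M x adv c c"
  unfolding leads_def by (rule exI[of _ 0]) simp

lemma leads_trans [trans]:
  assumes "leads M x adv a b" "leads M x adv b c"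
  shows "leads M x adv a c"
proof -
  obtain t u where "(step M x adv ^^ t) a = b" "(step M x adv ^^ u) b = c"
    using assms unfolding leads_def by blast
  then have "(step M x adv ^^ (u + t)) a = c" by (simp add: funpow_add)
  then show ?thesis unfolding leads_def by blast
qed

lemma leads_step: "step M x adv c = c' \<Longrightarrow> leads M x adv c c'"
  unfolding leads_def by (rule exI[of _ 1]) simp

text \<open>Halted configurations are fixed, so \<open>c\<close> and any accepting configuration of
  the run coincide at the later of their two times.\<close>

lemma accepts_if_leads_halted:
  assumes lead: "leads M x adv (init_conf M) c"
    and halt: "c_state c = tm_acc M \<or> c_state c = tm_rej M"
  shows "accepts M x adv \<longleftrightarrow> c_state c = tm_acc M"
proof -
  obtain t where t: "run M x adv t = c" using lead unfolding leads_def run_def by blast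
  show ?thesis
  proof
    assume "accepts M x adv"
    then obtain u where u: "c_state (run M x adv u) = tm_acc M" unfolding accepts_def by blast
    have "run M x adv (max t u) = c" "run M x adv (max t u) = run M x adv u"
      using run_halted[of M x adv t "max t u"] run_halted[of M x adv u "max t u"] halt t u by auto
    then show "c_state c = tm_acc M" using u by simp
  qed (use t accepts_def in metis)
qed

lemma interpreter_accepts_iff:
  assumes "leads (interpreter H) x adv (conf_of (Scan []) 0 0) (conf_of (if b then Accept else Reject) i r)"
  shows "accepts (interpreter H) x adv \<longleftrightarrow> b"
proof -
  have "init_conf (interpreter H) = conf_of (Scan []) 0 0"
    by (simp add: init_conf_def conf_of_def interpreter_def)
  then show ?thesis
    using accepts_if_leads_halted[of "interpreter H" x adv] assms code_halting_distinct
    by (auto simp: conf_of_def interpreter_def)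
qed

lemma leads_scan:
  assumes "m \<le> length x" "m \<le> 2"
  shows "leads (interpreter H) x adv (conf_of (Scan []) 0 0) (conf_of (Scan (take m x)) (Suc m) 0)"
  using assms
proof (induction m)
  case 0
  show ?case
    by (rule leads_step) (simp add: step_conf_of ctrls_iff tape_sym_simps move_ro_simps)
next
  case (Suc m)
  have "leads (interpreter H) x adv (conf_of (Scan (take m x)) (Suc m) 0)
      (conf_of (Scan (take (Suc m) x)) (Suc (Suc m)) 0)"
    using Suc.prems
    by (intro leads_step)
      (auto simp: step_conf_of ctrls_iff tape_sym_def move_ro_simps take_Suc_conv_app_nth)
  then show ?case using Suc leads_trans by (meson Suc_leD)
qed

text \<open>The head meets the right endmarker before any third bit, so the answer comes from
  \<open>H\<close>, whatever the advice.\<close>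

lemma interpreter_short:
  assumes "length x \<le> 2"
  shows "accepts (interpreter H) x adv \<longleftrightarrow> x \<in> H"
proof -
  have "leads (interpreter H) x adv (conf_of (Scan []) 0 0) (conf_of (Scan x) (Suc (length x)) 0)"
    using leads_scan[of "length x" x] assms by simp
  also have "leads (interpreter H) x adv (conf_of (Scan x) (Suc (length x)) 0)
      (conf_of (if x \<in> H then Accept else Reject) (Suc (length x)) 0)"
    using assms by (intro leads_step) (auto simp: step_conf_of ctrls_iff tape_sym_simps move_ro_simps)
  finally show ?thesis by (rule interpreter_accepts_iff)
qed

text \<open>A self-delimiting code over the binary advice alphabet; an opcode below 20 costs at most
  20 bits.\<close>

definition unary :: "nat \<Rightarrow> bool list" where
  "unary k = replicate k True @ [False]"

lemma leads_count:
  assumes adv: "adv = pre @ replicate k True @ post" and k: "k \<le> 19"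
    and R: "\<forall>i\<ge>3. \<not> R i" and p: "p \<le> length x + 1"
  shows "m \<le> k \<Longrightarrow> leads (interpreter H) x adv (conf_of (Main R 0) p (Suc (length pre)))
      (conf_of (Main R m) p (Suc (length pre + m)))"
proof (induction m)
  case 0
  then show ?case by (simp add: leads_refl)
next
  case (Suc m)
  have "adv = (pre @ replicate m True) @ True # (replicate (k - Suc m) True @ post)"
    using Suc.prems replicate_add[of m "Suc (k - Suc m)" True] by (simp add: adv)
  then have "tape_sym adv (Suc (length pre + m)) = 3"
    using tape_sym_simps(2)[of "pre @ replicate m True" True] by simp
  moreover have "length pre + m < length adv" using Suc.prems by (simp add: adv)
  ultimately have "leads (interpreter H) x adv (conf_of (Main R m) p (Suc (length pre + m)))
      (conf_of (Main R (Suc m)) p (Suc (length pre + Suc m)))"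
    using Suc.prems R k p by (intro leads_step) (auto simp: step_conf_of ctrls_iff move_ro_simps)
  then show ?case using Suc leads_trans by (meson Suc_leD)
qed

text \<open>Induction on the program with \<open>pre\<close> generalised: each decoded opcode passes
  from the remaining advice into the prefix. The last two conjuncts keep the control value in
  \<open>ctrls\<close> and the input head on the tape.\<close>

lemma leads_exec:
  assumes "set P \<subseteq> {..<20}" "\<forall>i\<ge>3. \<not> R i" "p \<le> length x + 1"
    and "adv = pre @ concat (map unary P) @ post" "exec x P (R, p) = (R', p')"
  shows "leads (interpreter H) x adv (conf_of (Main R 0) p (Suc (length pre)))
      (conf_of (Main R' 0) p' (Suc (length (pre @ concat (map unary P))))) \<and>
      (\<forall>i\<ge>3. \<not> R' i) \<and> p' \<le> length x + 1"
  using assms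
proof (induction P arbitrary: R p pre)
  case Nil
  then show ?case by (simp add: leads_refl)
next
  case (Cons k P)
  let ?R = "op_upd (tape_sym x p) k R" and ?p = "move_ro x p (op_dir k)"
  let ?pre = "pre @ unary k"
  have k: "k \<le> 19" using Cons.prems(1) by auto
  have R: "\<forall>i\<ge>3. \<not> ?R i" using op_upd_bounded Cons.prems(2) .
  have p: "?p \<le> length x + 1" by (simp add: move_ro_def)
  have IH: "leads (interpreter H) x adv (conf_of (Main ?R 0) ?p (Suc (length ?pre)))
      (conf_of (Main R' 0) p' (Suc (length (?pre @ concat (map unary P))))) \<and>
      (\<forall>i\<ge>3. \<not> R' i) \<and> p' \<le> length x + 1"
    using Cons.prems R p by (intro Cons.IH) (auto simp: exec_op_def)
  have "leads (interpreter H) x adv (conf_of (Main R 0) p (Suc (length pre)))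
      (conf_of (Main R k) p (Suc (length pre + k)))"
    using Cons.prems k
    by (intro leads_count[of _ _ k "False # concat (map unary P) @ post"]) (simp_all add: unary_def[of k])
  also have "leads (interpreter H) x adv (conf_of (Main R k) p (Suc (length pre + k)))
      (conf_of (Main ?R 0) ?p (Suc (length ?pre)))"
  proof (rule leads_step)
    have adv: "adv = (pre @ replicate k True) @ False # (concat (map unary P) @ post)"
      using Cons.prems(4) by (simp add: unary_def[of k])
    then have "tape_sym adv (Suc (length pre + k)) = 2"
      using tape_sym_simps(2)[of "pre @ replicate k True" False] by simp
    moreover have "length pre + k < length adv" by (simp add: adv)
    ultimately show "step (interpreter H) x adv (conf_of (Main R k) p (Suc (length pre + k)))
        = conf_of (Main ?R 0) ?p (Suc (length ?pre))"
      using k Cons.prems(2) by (simp add: step_conf_of ctrls_iff move_ro_simps(2)[of adv] unary_def)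
  qed
  also note conjunct1[OF IH]
  finally show ?case using IH by simp
qed

lemma interpreter_long:
  assumes x: "length x > 2" and P: "set P \<subseteq> {..<20}"
    and ex: "exec x P (\<lambda>r. r = 0, 3) = (R, p)"
  shows "accepts (interpreter H) x (concat (map unary P)) \<longleftrightarrow> R 1"
proof -
  let ?adv = "concat (map unary P)" and ?R0 = "\<lambda>r. r = (0::nat)"
  have run: "leads (interpreter H) x ?adv (conf_of (Main ?R0 0) 3 1)
      (conf_of (Main R 0) p (Suc (length ?adv))) \<and> (\<forall>i\<ge>3. \<not> R i) \<and> p \<le> length x + 1"
    using leads_exec[OF P _ _ _ ex, of ?adv "[]" "[]" H] x by simp
  have "leads (interpreter H) x ?adv (conf_of (Scan []) 0 0) (conf_of (Scan (take 2 x)) 3 0)"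
    using leads_scan[of 2 x] x by (simp add: numeral_3_eq_3 numeral_2_eq_2)
  \<comment> \<open>At position 3 a third bit is seen with two already stored, which starts the main
    phase with only register 0 set.\<close>
  also have "leads (interpreter H) x ?adv (conf_of (Scan (take 2 x)) 3 0) (conf_of (Main ?R0 0) 3 0)"
    using x by (intro leads_step) (auto simp: step_conf_of ctrls_iff tape_sym_def move_ro_simps)
  also have "leads (interpreter H) x ?adv (conf_of (Main ?R0 0) 3 0) (conf_of (Main ?R0 0) 3 1)"
    using x by (intro leads_step) (auto simp: step_conf_of ctrls_iff tape_sym_simps move_ro_simps)
  also note conjunct1[OF run]
  also have "leads (interpreter H) x ?adv (conf_of (Main R 0) p (Suc (length ?adv)))
      (conf_of (if R 1 then Accept else Reject) p (Suc (length ?adv)))"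
    using run by (intro leads_step) (auto simp: step_conf_of ctrls_iff tape_sym_simps move_ro_simps)
  finally show ?thesis by (rule interpreter_accepts_iff)
qed

subsection \<open>The two inclusions\<close>

lemma space_as_nat:
  fixes c :: nat
  obtains s :: "nat \<Rightarrow> nat" where
    "\<And>n. 0 < s n" "\<And>n. real c * log 2 (real n + 2) ^ c < real (s n)" "polylog (\<lambda>n. real (s n))"
proof -
  let ?h = "\<lambda>n. real c * log 2 (real n + 2) ^ c"
  define s where "s n = nat \<lfloor>?h n\<rfloor> + 1" for n
  have "polylog (\<lambda>n. log 2 (real n) + log 2 (real n))" by (intro polylog_add polylog_log)
  then have "polylog (\<lambda>n. log 2 (real n + 2))"
  proof (rule polylog_mono)
    fix n :: nat assume n: "n \<ge> 3"
    \<comment> \<open>Since \<open>n + 2 \<le> n * n\<close> for \<open>n \<ge> 3\<close>, the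
      shifted logarithm is at most twice \<open>log 2 n\<close>.\<close>
    have "real n + 2 \<le> 3 * real n" using n by simp
    also have "\<dots> \<le> real n * real n" using n by (intro mult_right_mono) auto
    finally have "log 2 (real n + 2) \<le> log 2 (real n * real n)"
      using n by (subst log_le_cancel_iff) auto
    then show "log 2 (real n + 2) \<le> log 2 (real n) + log 2 (real n)"
      using n by (simp add: log_mult)
  qed
  then have "polylog (\<lambda>n. ?h n + 1)"
    by (intro polylog_add polylog_mult polylog_power polylog_const) auto
  then have "polylog (\<lambda>n. real (s n))"
  proof (rule polylog_mono)
    show "real (s n) \<le> ?h n + 1" for n
    proof -
      have "0 \<le> ?h n" by simp
      then show ?thesis unfolding s_def by linarith
    qed
  qed
  moreover have "?h n < real (s n)" for n unfolding s_def by linarith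
  moreover have "0 < s n" for n by (simp add: s_def)
  ultimately show thesis using that by blast
qed

lemma length_concat_unary: "set P \<subseteq> {..<20} \<Longrightarrow> length (concat (map unary P)) \<le> 20 * length P"
  by (induction P) (auto simp: unary_def)

text \<open>
  The advice starts by rewinding the input head, which the machine leaves at position 3 after
  checking that the input is longer than 2.
\<close>
lemma interpreter_computable:
  assumes n: "n > 2" and f: "computable n f l"
  obtains adv where "length adv \<le> 20 * (n + 1 + l)"
    "\<And>x. length x = n \<Longrightarrow> accepts (interpreter H) x adv \<longleftrightarrow> f x"
proof -
  obtain P where P: "length P \<le> l" "implements n P f 0 1"
    using f unfolding computable_def by (metis one_less_numeral_iff semiring_norm(77) zero_less_numeral zero_neq_one)
  let ?P = "replicate (n + 1) 0 @ P"
  have set_P: "set ?P \<subseteq> {..<20}" using P(2) by (auto simp: implements_def)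
  have "length (concat (map unary ?P)) \<le> 20 * length ?P" by (rule length_concat_unary[OF set_P])
  then have len: "length (concat (map unary ?P)) \<le> 20 * (n + 1 + l)" using P(1) by simp
  have "accepts (interpreter H) x (concat (map unary ?P)) \<longleftrightarrow> f x" if x: "length x = n" for x
  proof -
    let ?R0 = "\<lambda>r. r = (0::nat)"
    have "exec x ?P (?R0, 3) = exec x P (exec x (replicate (n + 1) 0) (?R0, 3))"
      by (simp only: exec_simps)
    \<comment> \<open>As \<open>n > 2\<close>, the \<open>n + 1\<close> left moves exceed the three
      required, and the head rests at position 0.\<close>
    also have "\<dots> = exec x P (?R0, 0)" using n x by (subst exec_left) auto
    \<comment> \<open>Register 0 holds 1 and register 1 holds 0, so the addition stores
      \<open>f x\<close> in register 1.\<close>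
    also have "\<dots> = (?R0(1 := f x), 0)" using P(2) x by (simp add: implements_def)
    finally show ?thesis using interpreter_long[of x ?P _ 0 H] set_P n x by simp
  qed
  with len show thesis by (rule that)
qed

text \<open>For each length \<open>n \<ge> 3\<close>, the advice \<open>a n\<close> is hard-wired
  into a program for acceptance by \<open>M\<close>, and the unary code of that program becomes the
  new advice.\<close>

lemma polyL_subset_const_space: "nonuniform_polyL \<subseteq> const_space_qp_advice"
proof
  fix L assume "L \<in> nonuniform_polyL"
  then obtain M a c where M: "wf_tm M" and a: "qp_advice a"
    and space: "\<And>x. space_within M x (a (length x)) (real c * log 2 (real (length x) + 2) ^ c)"
    and dec: "decides M a L"
    unfolding nonuniform_polyL_def by blast
  obtain s where s: "\<And>n. 0 < s n" "\<And>n. real c * log 2 (real n + 2) ^ c < real (s n)"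
    and s_polylog: "polylog (\<lambda>n. real (s n))" by (rule space_as_nat[of c], rule that)
  have wpos: "c_wpos (run M x (a n) t) < s n" if "length x = n" for x n t
  proof -
    have "real (c_wpos (run M x (a n) t) + 1) < real (s n)"
      using space[of x] s(2)[of n] that unfolding space_within_def by (blast intro: le_less_trans)
    then show ?thesis by simp
  qed
  define N where "N n = tm_nstates M * ((n + 2) * ((length (a n) + 2) * (tm_nsyms M ^ s n * s n)))" for n
  have N: "quasipoly (\<lambda>n. real (N n))"
    unfolding N_def of_nat_mult of_nat_add of_nat_power
    by (intro quasipoly_mult quasipoly_add quasipoly_power quasipoly_const quasipoly_of_nat
        quasipoly_polylog[OF s_polylog] qp_advice_quasipoly[OF a] s_polylog) auto
  obtain k where k: "polylog (\<lambda>n. real (k n))" "\<And>n. n \<ge> 3 \<Longrightarrow> N n \<le> 2 ^ k n"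
    using quasipoly_le_power2[OF N] by blast
  define l where "l n = 1 + 2 ^ k n * ((5 * 2 ^ k n) ^ k n * (2 * n + 4))" for n
  \<comment> \<open>The critical factor is \<open>(5 * 2 ^ k n) ^ k n\<close>: a quasipolynomial
    base with a polylogarithmic exponent.\<close>
  have l: "quasipoly (\<lambda>n. real (20 * (n + 1 + l n)))"
    unfolding l_def of_nat_mult of_nat_add of_nat_power of_nat_numeral of_nat_1
    by (intro quasipoly_mult quasipoly_add quasipoly_power quasipoly_const quasipoly_of_nat k) auto
  define H where "H = {x \<in> L. length x \<le> 2}"
  have "\<exists>adv. length adv \<le> 20 * (n + 1 + l n) \<and>
      (\<forall>x. length x = n \<longrightarrow> accepts (interpreter H) x adv = accepts M x (a n))" if n: "n \<ge> 3" for n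
  proof -
    have "card (confs M n (length (a n)) (s n)) \<le> 2 ^ k n"
      using card_confs[of M n "length (a n)" "s n"] k(2)[OF n] unfolding N_def by (rule order.trans)
    then have "computable n (\<lambda>x. accepts M x (a n)) (l n)"
      unfolding l_def using M s(1) wpos by (intro computable_accepts)
    moreover have "n > 2" using n by simp
    ultimately show ?thesis using interpreter_computable[of n _ "l n" H] by metis
  qed
  then obtain b where b: "\<And>n. n \<ge> 3 \<Longrightarrow> length (b n) \<le> 20 * (n + 1 + l n)"
      "\<And>n x. n \<ge> 3 \<Longrightarrow> length x = n \<Longrightarrow> accepts (interpreter H) x (b n) = accepts M x (a n)"
    by metis
  \<comment> \<open>Lengths up to 2 get empty advice, as \<open>qp_adviceI\<close> demands; there
    \<open>H\<close> gives the answers.\<close>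
  define b' where "b' n = (if n \<le> 2 then [] else b n)" for n
  have "quasipoly (\<lambda>n. real (length (b' n)))"
  proof (rule quasipoly_mono[OF l])
    show "real (length (b' n)) \<le> real (20 * (n + 1 + l n))" if "n \<ge> 3" for n
      using b(1)[OF that] that unfolding of_nat_le_iff by (simp add: b'_def)
  qed
  then have "qp_advice b'" by (rule qp_adviceI) (simp_all add: b'_def)
  moreover have "decides (interpreter H) b' L"
    unfolding decides_def
  proof
    fix x :: "bool list"
    show "x \<in> L \<longleftrightarrow> accepts (interpreter H) x (b' (length x))"
    proof (cases "length x \<le> 2")
      case True
      then show ?thesis by (simp add: interpreter_short H_def)
    next
      case False
      then show ?thesis using dec b(2)[of "length x" x] by (simp add: b'_def decides_def)
    qed
  qed
  moreover have "space_within (interpreter H) x (b' (length x)) (real 1)" for x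
    using space_interpreter by simp
  ultimately show "L \<in> const_space_qp_advice"
    unfolding const_space_qp_advice_def using wf_interpreter by blast
qed

text \<open>The space constant \<open>s\<close> serves as both factor and exponent, since
  \<open>log 2 (n + 2) \<ge> 1\<close> even for the empty input.\<close>

lemma const_space_subset_polyL: "const_space_qp_advice \<subseteq> nonuniform_polyL"
proof
  fix L assume "L \<in> const_space_qp_advice"
  then obtain M a s where M: "wf_tm M" "qp_advice a" "decides M a L"
    and space: "\<And>x. space_within M x (a (length x)) (real s)"
    unfolding const_space_qp_advice_def by blast
  have "space_within M x (a (length x)) (real s * log 2 (real (length x) + 2) ^ s)" for x
  proof -
    have "1 \<le> log 2 (real (length x) + 2)" by (subst one_le_log_cancel_iff) auto
    then have "real s \<le> real s * log 2 (real (length x) + 2) ^ s"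
      using mult_left_mono[of 1 "log 2 (real (length x) + 2) ^ s" "real s"] by simp
    then show ?thesis using space[of x] unfolding space_within_def by (meson order.trans)
  qed
  then show "L \<in> nonuniform_polyL" unfolding nonuniform_polyL_def using M by blast
qed

theorem theorem2:
  shows "const_space_qp_advice = nonuniform_polyL"
  using const_space_subset_polyL polyL_subset_const_space by (rule equalityI)

end
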